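(* Let $a$ be a nonzero complex number. For all integers $n\ge 1$ and $m\ge 0$, $$S_2(n,m)=\sum_{m\le l\le n}\binom{-an}{n-l}(n-1)_{n-l}\binom{l-1}{m-1}B_{l-m}^{(l-m-n+1)}(an+1).$$
   Context: For any integer $r$ (positive, zero or negative), the Bernoulli polynomials of order $r$ are defined by $\left(\frac{t}{e^t-1}\right)^r e^{xt}=\sum_{k=0}^{\infty}B_k^{(r)}(x)\frac{t^k}{k!}$. $S_2(n,m)$ denotes the Stirling numbers of the second kind ($S_2(n,m)=0$ for $m>n$). $(y)_j=y(y-1)\cdots(y-j+1)$ is the falling factorial, $(y)_0=1$, and $\binom{y}{j}=\frac{(y)_j}{j!}$ for complex $y$ and integer $j\ge 0$, while $\binom{y}{j}=0$ for integers $j<0$. An empty sum is $0$. *)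

theory Defs
  imports
    Complex_Main
    "HOL-Computational_Algebra.Formal_Power_Series"
    "HOL-Combinatorics.Stirling"
begin

definition falling_fact :: "complex \<Rightarrow> nat \<Rightarrow> complex" where
  "falling_fact y j = (\<Prod>i<j. y - of_nat i)"

(* Unlike gchoose, the lower index is an integer, since the value 0 is needed
   for negative ones; no symmetry in the lower index is implied. *)
definition binom :: "complex \<Rightarrow> int \<Rightarrow> complex" where
  "binom y j = (if j < 0 then 0 else falling_fact y (nat j) / fact (nat j))"

lemma binom_of_nat: "binom y (int k) = y gchoose k"
  by (simp add: binom_def falling_fact_def gbinomial_prod_rev lessThan_atLeast0)

(* The series t / (exp t - 1); its constant coefficient is 1, so every integer
   power of it (powi) is a genuine one. *)
definition bernoulli_base :: "complex fps" where
  "bernoulli_base = fps_X / (fps_exp 1 - 1)"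

lemma bernoulli_base_mult: "bernoulli_base * (fps_exp 1 - 1) = fps_X"
proof -
  have sd: "subdegree (fps_exp 1 - 1 :: complex fps) = 1"
    by (rule subdegreeI) auto
  then have "(fps_exp 1 - 1 :: complex fps) dvd fps_X"
    by (subst fps_dvd_iff) auto
  then show ?thesis
    by (simp add: bernoulli_base_def)
qed

lemma bernoulli_base_nth_0: "fps_nth bernoulli_base 0 = 1"
proof -
  have "fps_nth (bernoulli_base * (fps_exp 1 - 1)) 1 = 1"
    by (simp add: bernoulli_base_mult)
  then show ?thesis
    by (simp add: fps_mult_nth)
qed

lemma bernoulli_base_powi_minus:
  "bernoulli_base powi r * bernoulli_base powi (- r) = 1"
proof -
  have "inverse bernoulli_base * bernoulli_base = 1"
    by (rule inverse_mult_eq_1) (simp add: bernoulli_base_nth_0)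
  then have "inverse bernoulli_base ^ k * bernoulli_base ^ k = 1" for k
    by (simp flip: power_mult_distrib)
  then show ?thesis
    by (auto simp: power_int_def mult.commute)
qed

(* bernoulli_poly r k x is the value at x of the k-th Bernoulli polynomial of
   order r. *)
definition bernoulli_poly :: "int \<Rightarrow> nat \<Rightarrow> complex \<Rightarrow> complex" where
  "bernoulli_poly r k x = fact k * fps_nth (bernoulli_base powi r * fps_exp x) k"

lemma bernoulli_poly_generating_function:
  "bernoulli_base powi r * fps_exp x = Abs_fps (\<lambda>k. bernoulli_poly r k x / fact k)"
  by (simp add: fps_eq_iff bernoulli_poly_def)

end

theory Submission
  imports Defs
begin

unbundle fps_syntax

text \<open>
  Put \<open>F = exp t - 1\<close> and \<open>c = a n\<close>. After cancelling factorials, the right-hand side is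
  \<open>(n-1)!/(m-1)!\<close> times the coefficient of \<open>t^(n-1)\<close> in
  \<open>exp ((c+1) t) F^(m-1) (1 + F) powr (-c)\<close>, the last factor being expanded by the binomial
  series. As \<open>1 + F = exp t\<close>, this series is \<open>exp t F^(m-1)\<close>, the derivative of \<open>F^m / m\<close>,
  and \<open>F^m / m!\<close> is the exponential generating function of the numbers \<open>S(n,m)\<close>.
\<close>

lemma fps_deriv_exp_minus_1_power:
  "fps_deriv ((fps_exp 1 - 1 :: 'a::field_char_0 fps) ^ Suc m)
     = of_nat (Suc m) * ((fps_exp 1 - 1) ^ m * fps_exp 1)"
  by (simp add: fps_deriv_power' mult_ac del: power_Suc of_nat_Suc)

text \<open>Since \<open>exp t = F + 1\<close>, the derivative of \<open>F^(k+1)\<close> is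
  \<open>(k+1) (F^(k+1) + F^k)\<close>; on coefficients this is the recurrence of the Stirling
  numbers, up to factorials.\<close>

lemma Stirling_conv_fps_exp_power:
  "of_nat (Stirling n m) * fact m = (fact n * ((fps_exp 1 - 1 :: 'a::field_char_0 fps) ^ m) $ n)"
proof (induction n m rule: Stirling.induct)
  case (4 n k)
  let ?F = "fps_exp 1 - 1 :: 'a fps"
  have "of_nat (Suc n) * (?F ^ Suc k) $ Suc n = fps_deriv (?F ^ Suc k) $ n"
    by (simp add: fps_deriv_nth del: power_Suc)
  also have "?F ^ k * fps_exp 1 = ?F ^ Suc k + ?F ^ k"
    by (simp add: algebra_simps)
  then have "fps_deriv (?F ^ Suc k) $ n = of_nat (Suc k) * ((?F ^ Suc k) $ n + (?F ^ k) $ n)"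
    by (simp only: fps_deriv_exp_minus_1_power fps_of_nat [symmetric] fps_mult_left_const_nth
        fps_add_nth)
  finally have *: "of_nat (Suc n) * (?F ^ Suc k) $ Suc n
      = of_nat (Suc k) * ((?F ^ Suc k) $ n + (?F ^ k) $ n)" .
  have "fact (Suc n) * (?F ^ Suc k) $ Suc n
      = fact n * (of_nat (Suc n) * (?F ^ Suc k) $ Suc n)"
    by (simp only: fact_Suc ac_simps of_nat_mult)
  also have "\<dots> = of_nat (Suc k) * (fact n * (?F ^ Suc k) $ n + fact n * (?F ^ k) $ n)"
    unfolding * by (simp only: algebra_simps)
  also have "\<dots> = of_nat (Suc k) * (of_nat (Stirling n (Suc k)) * fact (Suc k)
      + of_nat (Stirling n k) * fact k)"
    using 4 by simp
  also have "\<dots> = of_nat (Stirling (Suc n) (Suc k)) * fact (Suc k)"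
    by (simp add: algebra_simps)
  finally show ?case by simp
qed (simp_all)

text \<open>Differentiating \<open>F^(m+1)\<close> lowers the coefficient index by one and yields a
  factor \<open>m+1\<close>, which reduces \<open>(m+1)!\<close> to \<open>m!\<close>.\<close>

lemma Stirling_Suc_Suc_conv_fps_exp:
  "of_nat (Stirling (Suc n) (Suc m)) * fact m
     = (fact n * ((fps_exp 1 - 1 :: 'a::field_char_0 fps) ^ m * fps_exp 1) $ n)"
proof -
  let ?F = "fps_exp 1 - 1 :: 'a fps"
  have "of_nat (Suc n) * (?F ^ Suc m) $ Suc n = fps_deriv (?F ^ Suc m) $ n"
    by (simp add: fps_deriv_nth del: power_Suc)
  also have "\<dots> = of_nat (Suc m) * (?F ^ m * fps_exp 1) $ n"
    by (simp only: fps_deriv_exp_minus_1_power fps_of_nat [symmetric] fps_mult_left_const_nth)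
  finally have "of_nat (Suc m) * (of_nat (Stirling (Suc n) (Suc m)) * fact m)
      = of_nat (Suc m) * (fact n * (?F ^ m * fps_exp 1) $ n)"
    using Stirling_conv_fps_exp_power [of "Suc n" "Suc m", where ?'a = 'a]
    by (simp only: fact_Suc of_nat_mult mult.assoc mult.left_commute)
  then show ?thesis
    by (metis mult_cancel_left of_nat_neq_0)
qed

text \<open>The binomial series \<open>B\<close> satisfies \<open>(1 + X) B' = c B\<close>.
  Substituting \<open>F\<close> and using \<open>F' = exp t = 1 + F\<close> gives
  \<open>G' = c G\<close> for the composite \<open>G\<close>, and \<open>G\<close> has constant term
  1.\<close>

lemma fps_binomial_compose_exp_minus_1:
  "fps_binomial c oo (fps_exp 1 - 1) = fps_exp (c :: 'a::field_char_0)"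
proof -
  let ?F = "fps_exp 1 - 1 :: 'a fps"
  let ?G = "fps_binomial c oo ?F"
  have "(1 + fps_X) * fps_deriv (fps_binomial c) = fps_const c * fps_binomial c"
    by (simp add: fps_binomial_deriv fps_divide_unit mult.left_commute inverse_mult_eq_1')
  then have "((1 + fps_X) * fps_deriv (fps_binomial c)) oo ?F = fps_const c * ?G"
    by (simp add: fps_compose_mult_distrib)
  then have "fps_deriv ?G = fps_const c * ?G"
    by (simp add: fps_compose_mult_distrib fps_compose_add_distrib fps_compose_deriv mult.commute)
  then show ?thesis
    by (subst (asm) fps_exp_unique_ODE) simp
qed

lemma fps_mult_power_nth_eq_0:
  fixes f g :: "'a::idom fps"
  assumes "g $ 0 = 0" and "n < k"
  shows "(f * g ^ k) $ n = 0"
  using assms by (auto simp: fps_mult_nth startsby_zero_power_prefix intro!: sum.neutral)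

lemma fps_mult_compose_nth:
  fixes f g h :: "'a::idom fps"
  assumes "g $ 0 = 0"
  shows "(f * (h oo g)) $ n = (\<Sum>k\<le>n. h $ k * (f * g ^ k) $ n)"
proof -
  \<comment> \<open>As \<open>g^k\<close> has no terms below degree \<open>k\<close>, the bound
    \<open>j\<close> can be raised to \<open>n\<close>; a bound independent of \<open>j\<close> lets
    the two sums be exchanged.\<close>
  have "(h oo g) $ j = (\<Sum>k\<le>n. h $ k * (g ^ k) $ j)" if "j \<le> n" for j
    unfolding fps_compose_nth using that assms
    by (intro sum.mono_neutral_left) (auto simp: startsby_zero_power_prefix)
  then have "(f * (h oo g)) $ n = (\<Sum>i=0..n. f $ i * (\<Sum>k\<le>n. h $ k * (g ^ k) $ (n - i)))"
    by (simp add: fps_mult_nth)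
  also have "\<dots> = (\<Sum>k\<le>n. h $ k * (f * g ^ k) $ n)"
    unfolding fps_mult_nth sum_distrib_left
    by (subst sum.swap) (simp add: mult.left_commute)
  finally show ?thesis .
qed

text \<open>This is the expansion of \<open>(1 + F) powr (-c) = exp (-c t)\<close> in powers of
  \<open>F\<close>, multiplied by \<open>F^m exp ((c+1) t)\<close>. The sum stops at
  \<open>n - m\<close> because \<open>F^(m+k)\<close> starts in degree \<open>m + k\<close>.\<close>

lemma sum_gchoose_fps_exp_nth:
  fixes c :: "'a::field_char_0"
  assumes "m \<le> n"
  shows "(\<Sum>k\<le>n - m. (- c gchoose k) * ((fps_exp 1 - 1) ^ (m + k) * fps_exp (c + 1)) $ n)
    = ((fps_exp 1 - 1) ^ m * fps_exp 1) $ n"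
proof -
  let ?F = "fps_exp 1 - 1 :: 'a fps"
  let ?f = "?F ^ m * fps_exp (c + 1)"
  have pow: "?F ^ (m + k) * fps_exp (c + 1) = ?f * ?F ^ k" for k
    by (simp add: power_add mult_ac)
  have zero: "(?f * ?F ^ k) $ n = 0" if "n - m < k" for k
    using fps_mult_power_nth_eq_0 [of ?F n "m + k" "fps_exp (c + 1)"] that
    by (simp add: power_add mult_ac)
  have "(\<Sum>k\<le>n - m. (- c gchoose k) * (?F ^ (m + k) * fps_exp (c + 1)) $ n)
      = (\<Sum>k\<le>n. fps_binomial (- c) $ k * (?f * ?F ^ k) $ n)"
    unfolding pow using zero
    by (intro sum.mono_neutral_cong_left) auto
  also have "\<dots> = (?f * (fps_binomial (- c) oo ?F)) $ n"
    by (simp add: fps_mult_compose_nth)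
  also have "?f * (fps_binomial (- c) oo ?F) = ?F ^ m * fps_exp 1"
    by (simp add: fps_binomial_compose_exp_minus_1 mult.assoc fps_exp_add_mult [symmetric])
  finally show ?thesis .
qed

lemma bernoulli_base_powi_mult_fps_X_power:
  "bernoulli_base powi (- int p) * fps_X ^ p = (fps_exp 1 - 1) ^ p"
proof -
  have "bernoulli_base powi (- int p) * fps_X ^ p
      = (bernoulli_base powi int p * bernoulli_base powi (- int p)) * (fps_exp 1 - 1) ^ p"
    by (simp add: bernoulli_base_mult [symmetric] power_mult_distrib mult_ac)
  then show ?thesis
    by (simp only: bernoulli_base_powi_minus mult_1)
qed

text \<open>For order \<open>-p\<close> the generating function is \<open>(F/t)^p exp (x t)\<close>;
  clearing the denominator \<open>t^p\<close> shifts the index from \<open>k\<close> to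
  \<open>k + p\<close>.\<close>

lemma bernoulli_poly_uminus_of_nat:
  "bernoulli_poly (- int p) k x = fact k * ((fps_exp 1 - 1) ^ p * fps_exp x) $ (k + p)"
proof -
  have "(fps_exp 1 - 1) ^ p * fps_exp x = bernoulli_base powi (- int p) * fps_exp x * fps_X ^ p"
    by (simp only: bernoulli_base_powi_mult_fps_X_power [symmetric] mult_ac)
  then have "((fps_exp 1 - 1) ^ p * fps_exp x) $ (k + p)
      = (bernoulli_base powi (- int p) * fps_exp x) $ k"
    by (simp only: fps_X_power_mult_right_nth) simp
  then show ?thesis
    by (simp only: bernoulli_poly_def)
qed

lemma falling_fact_of_nat:
  assumes "k \<le> n"
  shows "falling_fact (of_nat n) k = fact n / fact (n - k)"
proof -
  have "falling_fact (of_nat n) k = fact k * (of_nat n gchoose k)"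
    by (simp add: falling_fact_def gbinomial_prod_rev lessThan_atLeast0)
  then show ?thesis
    using assms by (simp add: binomial_gbinomial [symmetric] binomial_fact)
qed

theorem theorem11:
  fixes a :: complex and n m :: nat
  assumes "a \<noteq> 0" and "n \<ge> 1"
  shows "of_nat (Stirling n m) =
    (\<Sum>l = m..n. binom (- a * of_nat n) (int n - int l)
       * falling_fact (of_nat n - 1) (n - l)
       * binom (of_nat l - 1) (int m - 1)
       * bernoulli_poly (int l - int m - int n + 1) (l - m) (a * of_nat n + 1))"
proof (cases "m = 0 \<or> n < m")
  case True
  obtain N where "n = Suc N"
    using assms(2) by (cases n) auto
  \<comment> \<open>For \<open>m = 0\<close> each summand contains a binomial coefficient with lower
    index -1, hence vanishes, and so does \<open>S(n,0)\<close> as \<open>n\<close> is positive. For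
    \<open>n < m\<close> the sum is empty.\<close>
  with True show ?thesis
    by (auto simp: binom_def)
next
  case False
  obtain N where n: "n = Suc N"
    using assms(2) by (cases n) auto
  obtain M where m: "m = Suc M"
    using False by (cases m) auto
  have le: "M \<le> N"
    using False n m by simp
  define c where "c = a * of_nat n"
  let ?F = "fps_exp 1 - 1 :: complex fps"
  let ?T = "\<lambda>k. (- c gchoose k) * (?F ^ (M + k) * fps_exp (c + 1)) $ N"
  \<comment> \<open>The factorials of \<open>l - 1\<close> and \<open>l - m\<close> cancel, leaving
    a prefactor independent of \<open>l\<close>.\<close>
  have summand: "binom (- a * of_nat n) (int n - int l)
       * falling_fact (of_nat n - 1) (n - l)
       * binom (of_nat l - 1) (int m - 1)
       * bernoulli_poly (int l - int m - int n + 1) (l - m) (a * of_nat n + 1)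
     = fact N / fact M * ?T (n - l)" if "l \<in> {m..n}" for l
  proof -
    obtain L where l: "l = Suc L" and L: "M \<le> L" "L \<le> N"
      using \<open>l \<in> {m..n}\<close> m n by (cases l) auto
    have "binom (- a * of_nat n) (int n - int l) = (- c gchoose (N - L))"
      using binom_of_nat [of "- c" "N - L"] L by (simp add: c_def n l of_nat_diff)
    moreover have "falling_fact (of_nat n - 1) (n - l) = fact N / fact L"
      using falling_fact_of_nat [of "N - L" N] L by (simp add: n l)
    moreover have "binom (of_nat l - 1) (int m - 1) = fact L / (fact M * fact (L - M))"
      using binom_of_nat [of "of_nat L" M] L
      by (simp add: m l binomial_gbinomial [symmetric] binomial_fact)
    \<comment> \<open>With \<open>p = M + (N - L)\<close>, the shifted index
      \<open>(L - M) + p\<close> is \<open>N\<close> for every \<open>l\<close>, so all summands use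
      the same coefficient.\<close>
    moreover have "int l - int m - int n + 1 = - int (M + (N - L))"
      using L by (simp add: n m l of_nat_diff)
    then have "bernoulli_poly (int l - int m - int n + 1) (l - m) (a * of_nat n + 1)
        = fact (L - M) * (?F ^ (M + (N - L)) * fps_exp (c + 1)) $ N"
      using L by (simp only: bernoulli_poly_uminus_of_nat c_def) (simp add: l m)
    ultimately show ?thesis
      by (simp add: n l)
  qed
  have "(\<Sum>l = m..n. binom (- a * of_nat n) (int n - int l)
       * falling_fact (of_nat n - 1) (n - l)
       * binom (of_nat l - 1) (int m - 1)
       * bernoulli_poly (int l - int m - int n + 1) (l - m) (a * of_nat n + 1))
     = (\<Sum>l = m..n. fact N / fact M * ?T (n - l))"
    by (rule sum.cong [OF refl summand])
  also have "\<dots> = fact N / fact M * (\<Sum>k\<le>N - M. ?T k)"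
    unfolding sum_distrib_left
    by (rule sum.reindex_bij_witness [of _ "\<lambda>k. n - k" "\<lambda>l. n - l"]) (use le n m in auto)
  also have "\<dots> = fact N / fact M * (?F ^ M * fps_exp 1) $ N"
    by (simp only: sum_gchoose_fps_exp_nth [OF le])
  also have "\<dots> = of_nat (Stirling n m)"
    using Stirling_Suc_Suc_conv_fps_exp [of N M, where ?'a = complex]
    by (simp add: n m field_simps del: Stirling.simps)
  finally show ?thesis by simp
qed

end
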